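(* Let $a\in\mathbb{C}$ and let $(p_{n;a})_{n\ge0}$ be the associated polynomial sequence. (i) For every integer $n\ge 0$, $$e^{-t}p_{n;a}(t)=\sum_{j=0}^\infty(-1)^n\frac{(-t)^j}{j!}\frac{(aj)_n}{n!}=\sum_{j=0}^\infty k^{-aj}(n)\frac{(-t)^j}{j!},\qquad t\in\mathbb{C}.$$ (ii) For every $z\in\mathbb{C}$ with $|z|<1$, $$e^{-t}\sum_{n=0}^\infty p_{n;a}(t)z^n=e^{-t(1-z)^a},\qquad t\in\mathbb{C}.$$ In particular, $\sum_{n=0}^\infty p_{n;a}(t)=e^t$ for $\operatorname{Re}a>0$ and $t\in\mathbb{C}$. (iii) For $\operatorname{Re}a>0$, $(p_{n;a}(t))_{n\ge0}\in\ell^1$ and $$\Vert(p_{n;a}(t))_{n\ge0}\Vert_1\le e^{(c_a+1)|t|},\qquad t\in\mathbb{C}.$$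
   Context: The falling factorial is $(z)_n=z(z-1)\cdots(z-n+1)$ for $n\ge 1$, $(z)_0=1$. For $a\in\mathbb{C}$, the array $(b_{j,n;a})_{n\ge 1,\,1\le j\le n}$ is defined by $b_{1,n;a}=(a)_n$, $b_{n,n;a}=a^n$ for $n\ge 1$, and $b_{j,n+1;a}=(aj-n)b_{j,n;a}+a\,b_{j-1,n;a}$ for $2\le j\le n$. The polynomials $p_{n;a}$ are $p_{0;a}(t)=1$ and $p_{n;a}(t)=\frac{(-1)^n}{n!}\sum_{l=1}^n b_{l,n;a}(-t)^l$ for $n\ge1$. The Cesàro numbers are $k^\alpha(0)=1$, $k^\alpha(n)=\frac{\alpha(\alpha+1)\cdots(\alpha+n-1)}{n!}$ for $n\ge1$, $\alpha\in\mathbb{C}$. For $|z|<1$, $(1-z)^a=e^{a\log(1-z)}$ with the principal logarithm. $\ell^1$ is the space of absolutely summable complex sequences $f=(f(n))_{n\ge0}$, with norm $\Vert f\Vert_1=\sum_{n=0}^\infty|f(n)|$. For $\operatorname{Re}a>0$, $$c_a=2^{[\operatorname{Re}a]+1}\,\frac{|a-[\operatorname{Re}a]|}{\operatorname{Re}a-[\operatorname{Re}a]}\,\frac{\Gamma\bigl(1-(\operatorname{Re}a-[\operatorname{Re}a])\bigr)}{\bigl|\Gamma\bigl(1-(a-[\operatorname{Re}a])\bigr)\bigr|},$$ where $[x]$ is the integer part of a real number $x$ and $\Gamma$ is the Euler Gamma function.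
   Formalization: The formula for c_a divides by zero when Re a is an integer; there c_a is read as 2^{a+1} if a is a positive integer, and as +∞ (so the norm bound is void for t ≠ 0) if a is not real. *)

theory Defs
  imports "HOL-Analysis.Analysis"
begin

definition falling_factorial :: "complex \<Rightarrow> nat \<Rightarrow> complex" where
  "falling_factorial z n = (\<Prod>i<n. z - of_nat i)"

text \<open>
  \<open>b_array a n j\<close> is $b_{j,n;a}$. Only the range $1 \le j \le n$ is meaningful; the function is
  extended by 0 outside of it, and no value outside of it is ever used.
\<close>

fun b_array :: "complex \<Rightarrow> nat \<Rightarrow> nat \<Rightarrow> complex" where
  "b_array a 0 j = 0"
| "b_array a (Suc n) j =
    (if j = 1 then falling_factorial a (Suc n)
     else if j = Suc n then a ^ Suc n
     else if 2 \<le> j \<and> j \<le> n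
       then (a * of_nat j - of_nat n) * b_array a n j + a * b_array a n (j - 1)
     else 0)"

lemma b_array_1: "n \<ge> 1 \<Longrightarrow> b_array a n 1 = falling_factorial a n"
  by (cases n) auto

lemma b_array_diag: "n \<ge> 1 \<Longrightarrow> b_array a n n = a ^ n"
  by (cases n) (auto simp: falling_factorial_def)

lemma b_array_rec:
  "2 \<le> j \<Longrightarrow> j \<le> n \<Longrightarrow>
    b_array a (n + 1) j = (a * of_nat j - of_nat n) * b_array a n j + a * b_array a n (j - 1)"
  by simp

definition p_poly :: "complex \<Rightarrow> nat \<Rightarrow> complex \<Rightarrow> complex" where
  "p_poly a n t =
    (if n = 0 then 1 else (-1) ^ n / fact n * (\<Sum>l=1..n. b_array a n l * (- t) ^ l))"

definition cesaro_number :: "complex \<Rightarrow> nat \<Rightarrow> complex" where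
  "cesaro_number \<alpha> n = pochhammer \<alpha> n / fact n"

definition ell1 :: "(nat \<Rightarrow> complex) set" where
  "ell1 = {f. summable (\<lambda>n. norm (f n))}"

definition ell1_norm :: "(nat \<Rightarrow> complex) \<Rightarrow> real" where
  "ell1_norm f = (\<Sum>n. norm (f n))"

text \<open>
  The constant $c_a$ contains the quotient $|a - [\mathrm{Re}\,a]| / (\mathrm{Re}\,a - [\mathrm{Re}\,a])$,
  whose denominator vanishes when $\mathrm{Re}\,a$ is an integer. We therefore let $c_a$ take values
  in the extended reals. If $\mathrm{Re}\,a$ is an integer and $a$ is not real, the quotient is
  a positive number over 0, that is, \<open>\<infinity>\<close>. If $a$ itself is an integer, the quotient is 0/0; it is
  read as 1, the value it has at all non-integer real $a$. (The values that \<open>x / 0 = 0\<close> in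
  \<^typ>\<open>real\<close> or \<open>0 / 0 = 0\<close> in \<^typ>\<open>ereal\<close> would produce make the norm estimate false,
  e.g. for $a = 2$.)
\<close>

definition c_quotient :: "complex \<Rightarrow> ereal" where
  "c_quotient a =
    (if a = of_int \<lfloor>Re a\<rfloor> then 1
     else ereal (norm (a - of_int \<lfloor>Re a\<rfloor>)) / ereal (Re a - of_int \<lfloor>Re a\<rfloor>))"

definition c_const :: "complex \<Rightarrow> ereal" where
  "c_const a =
    ereal (2 powi (\<lfloor>Re a\<rfloor> + 1)) * c_quotient a *
    ereal (Gamma (1 - (Re a - of_int \<lfloor>Re a\<rfloor>)) / norm (Gamma (1 - (a - of_int \<lfloor>Re a\<rfloor>))))"

lemma c_const_eq:
  assumes "Re a \<notin> \<int>"
  shows "c_const a = ereal (2 powi (\<lfloor>Re a\<rfloor> + 1) *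
    (norm (a - of_int \<lfloor>Re a\<rfloor>) / (Re a - of_int \<lfloor>Re a\<rfloor>)) *
    (Gamma (1 - (Re a - of_int \<lfloor>Re a\<rfloor>)) / norm (Gamma (1 - (a - of_int \<lfloor>Re a\<rfloor>)))))"
proof -
  have "Re a - of_int \<lfloor>Re a\<rfloor> \<noteq> 0" using assms by (metis Ints_of_int eq_iff_diff_eq_0)
  moreover have "a \<noteq> of_int \<lfloor>Re a\<rfloor>" using calculation by (metis Re_complex_of_real eq_iff_diff_eq_0 of_real_of_int_eq)
  ultimately show ?thesis by (simp add: c_const_def c_quotient_def)
qed

lemma c_const_integer:
  assumes "a = of_int m"
  shows "c_const a = ereal (2 powi (m + 1))"
  using assms by (simp add: c_const_def c_quotient_def)

lemma c_const_infinity: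
  assumes "Re a \<in> \<int>" "Im a \<noteq> 0"
  shows "c_const a = \<infinity>"
proof -
  obtain m where m: "Re a = of_int m" using assms(1) by (auto elim: Ints_cases)
  have ne: "a \<noteq> of_int m" using assms(2) by auto
  have "1 - (a - of_int m) \<noteq> of_int k" if "k \<le> 0" for k
  proof
    assume "1 - (a - of_int m) = of_int k"
    then have "Re (1 - (a - of_int m)) = of_int k" by (metis Re_complex_of_real of_real_of_int_eq)
    with m that show False by simp
  qed
  then have "1 - (a - of_int m) \<notin> \<int>\<^sub>\<le>\<^sub>0"
    by (blast elim: nonpos_Ints_cases)
  then have "Gamma (1 - (a - of_int m)) \<noteq> 0" by (simp add: Gamma_eq_zero_iff)
  with m ne show ?thesis
    by (simp add: c_const_def c_quotient_def divide_ereal_def del: minus_diff_eq)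
qed

definition exp_ereal :: "ereal \<Rightarrow> ereal" where
  "exp_ereal x =
    (if x = \<infinity> then \<infinity> else if x = -\<infinity> then 0 else ereal (exp (real_of_ereal x)))"

lemma exp_ereal_simps [simp]:
  "exp_ereal (ereal x) = ereal (exp x)"
  "exp_ereal \<infinity> = \<infinity>"
  "exp_ereal (-\<infinity>) = 0"
  by (simp_all add: exp_ereal_def)

end

theory Submission imports Defs
begin

text \<open>
  The numbers $k^{-a}(n)$ are the Taylor coefficients of $(1-z)^a$, so $k^{-aj}(n)$, as a sequence
  in $n$, is the $j$-fold convolution power of $k^{-a}$ (Vandermonde). Expanding $e^{-t(1-z)^a}$ as
  $\sum_j \frac{(-t)^j}{j!} (1-z)^{aj}$ and collecting powers of $z$ gives a generating function
  whose $n$-th coefficient is $\sum_j k^{-aj}(n) \frac{(-t)^j}{j!}$. The proof makes this precise in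
  two independent steps.

  The first step identifies that coefficient with $e^{-t} p_{n;a}(t)$. The recursion for
  $b_{l,n;a}$ is exactly what expresses the polynomial $(ax)_n$ in the basis of falling factorials,
  $(ax)_n = \sum_l b_{l,n;a} (x)_l$ (\<open>falling_factorial_scaled\<close>), and
  $\sum_j \frac{s^j}{j!} (j)_l = s^l e^s$ since $(j)_l / j! = 1/(j-l)!$. This is part (i).

  The second step exchanges the two summations (\<open>p_poly_generating_function\<close>). If
  $K = \sum_n |k^{-a}(n) z^n|$ is finite, submultiplicativity of the $\ell^1$ norm under convolution
  gives $\sum_n |k^{-aj}(n) z^n| \le K^j$, so the double series is dominated by $e^{K|t|}$. One
  therefore gets at once the value of $\sum_n p_{n;a}(t) z^n$ and the bound
  $\sum_n |p_{n;a}(t) z^n| \le e^{(K+1)|t|}$. Part (ii) is the case $|z| < 1$, where $K$ is finite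
  for every $a$. The case $z = 1$ needs $\mathrm{Re}\,a > 0$, when $k^{-a}(n) = O(n^{-\mathrm{Re}\,a-1})$
  is summable with sum $0$; it gives the remaining claims once $\Vert k^{-a}\Vert_1 \le c_a$ is known.

  For this last bound (\<open>ell1_norm_cesaro_le_c_const\<close>) write $a = m + b$ with $m = [\mathrm{Re}\,a]$.
  For real $0 < s \le 1$ only the zeroth coefficient of $(1-z)^s$ is positive and the partial sums
  are nonnegative, whence $\Vert k^{-s}\Vert_1 \le 2$. This gives $\Vert k^{-m}\Vert_1 \le 2^m$, and
  $k^{-b}$ is compared term by term with $k^{-\mathrm{Re}\,b}$; the ratio is controlled by
  $|\Gamma(w)| \le \Gamma(\mathrm{Re}\,w)$.
\<close>

section \<open>Convolution of Cesaro numbers\<close>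

lemma cesaro_number_uminus: "cesaro_number (- x) n = (-1) ^ n * (x gchoose n)"
  by (simp add: cesaro_number_def gbinomial_pochhammer flip: power_mult_distrib)

lemma falling_factorial_eq_gbinomial: "falling_factorial x n = fact n * (x gchoose n)"
  by (simp add: falling_factorial_def gbinomial_prod_rev atLeast0LessThan)

lemma falling_factorial_Suc: "falling_factorial x (Suc n) = falling_factorial x n * (x - of_nat n)"
  by (simp add: falling_factorial_def)

text \<open>
  The coefficient form of $(1-z)^{-\alpha} (1-z)^{-\beta} = (1-z)^{-(\alpha+\beta)}$, which is
  Vandermonde's identity up to signs.
\<close>

lemma cesaro_number_convolution:
  "(\<Sum>i\<le>n. cesaro_number \<alpha> i * cesaro_number \<beta> (n - i)) = cesaro_number (\<alpha> + \<beta>) n"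
proof -
  have "cesaro_number \<alpha> i * cesaro_number \<beta> (n - i)
      = (-1) ^ n * (((-\<alpha>) gchoose i) * ((-\<beta>) gchoose (n - i)))" if "i \<le> n" for i
    using that cesaro_number_uminus[of "-\<alpha>" i] cesaro_number_uminus[of "-\<beta>" "n - i"]
    by (simp add: power_add[symmetric])
  moreover have "(\<Sum>i\<le>n. ((-\<alpha>) gchoose i) * ((-\<beta>) gchoose (n - i))) = ((-\<alpha>-\<beta>) gchoose n)"
    using gbinomial_Vandermonde[of "-\<alpha>" "-\<beta>" n] by (simp add: atMost_atLeast0)
  ultimately show ?thesis
    using cesaro_number_uminus[of "-(\<alpha>+\<beta>)" n] by (simp add: sum_distrib_left[symmetric] add.commute)
qed

text \<open>
  The triangle inequality in each coefficient reduces this to the Cauchy product of the two series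
  of norms, which has nonnegative terms.
\<close>

lemma Cauchy_product_norm_le:
  fixes f g :: "nat \<Rightarrow> 'a::{real_normed_algebra,banach}"
  assumes "summable (\<lambda>n. norm (f n))" and "summable (\<lambda>n. norm (g n))"
  shows "summable (\<lambda>n. norm (\<Sum>i\<le>n. f i * g (n - i)))"
    and "(\<Sum>n. norm (\<Sum>i\<le>n. f i * g (n - i))) \<le> (\<Sum>n. norm (f n)) * (\<Sum>n. norm (g n))"
proof -
  let ?c = "\<lambda>n. \<Sum>i\<le>n. norm (f i) * norm (g (n - i))"
  have c: "?c sums ((\<Sum>n. norm (f n)) * (\<Sum>n. norm (g n)))"
    using assms by (intro Cauchy_product_sums) auto
  have le: "norm (\<Sum>i\<le>n. f i * g (n - i)) \<le> ?c n" for n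
    by (intro order_trans[OF norm_sum] sum_mono norm_mult_ineq)
  show s: "summable (\<lambda>n. norm (\<Sum>i\<le>n. f i * g (n - i)))"
    using le by (intro summable_comparison_test'[OF sums_summable[OF c], of 0]) auto
  show "(\<Sum>n. norm (\<Sum>i\<le>n. f i * g (n - i))) \<le> (\<Sum>n. norm (f n)) * (\<Sum>n. norm (g n))"
    using suminf_le[OF le s sums_summable[OF c]] sums_unique[OF c] by simp
qed

text \<open>
  The weight $z^n$ is multiplicative, so weighted Cesaro sequences are convolved in the same way as
  the unweighted ones. Keeping the weight makes the statements cover both the interior of the disc
  and the boundary point $z = 1$.
\<close>

lemma cesaro_series_add:
  assumes "summable (\<lambda>n. norm (cesaro_number \<alpha> n * z ^ n))"
    and "summable (\<lambda>n. norm (cesaro_number \<beta> n * z ^ n))"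
  shows "summable (\<lambda>n. norm (cesaro_number (\<alpha> + \<beta>) n * z ^ n))"
    and "(\<Sum>n. norm (cesaro_number (\<alpha> + \<beta>) n * z ^ n))
      \<le> (\<Sum>n. norm (cesaro_number \<alpha> n * z ^ n)) * (\<Sum>n. norm (cesaro_number \<beta> n * z ^ n))"
    and "(\<Sum>n. cesaro_number (\<alpha> + \<beta>) n * z ^ n)
      = (\<Sum>n. cesaro_number \<alpha> n * z ^ n) * (\<Sum>n. cesaro_number \<beta> n * z ^ n)"
proof -
  have conv: "cesaro_number (\<alpha> + \<beta>) n * z ^ n =
      (\<Sum>i\<le>n. (cesaro_number \<alpha> i * z ^ i) * (cesaro_number \<beta> (n - i) * z ^ (n - i)))" for n
  proof -
    have summand: "(cesaro_number \<alpha> i * z ^ i) * (cesaro_number \<beta> (n - i) * z ^ (n - i))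
        = cesaro_number \<alpha> i * cesaro_number \<beta> (n - i) * z ^ n" if "i \<in> {..n}" for i
    proof -
      have "z ^ n = z ^ i * z ^ (n - i)" using that by (simp flip: power_add)
      then show ?thesis by simp
    qed
    show ?thesis
      unfolding cesaro_number_convolution[symmetric] sum_distrib_right
      by (rule sum.cong[OF refl], rule summand[symmetric])
  qed
  show "summable (\<lambda>n. norm (cesaro_number (\<alpha> + \<beta>) n * z ^ n))"
    and "(\<Sum>n. norm (cesaro_number (\<alpha> + \<beta>) n * z ^ n))
      \<le> (\<Sum>n. norm (cesaro_number \<alpha> n * z ^ n)) * (\<Sum>n. norm (cesaro_number \<beta> n * z ^ n))"
    unfolding conv by (rule Cauchy_product_norm_le[OF assms])+
  show "(\<Sum>n. cesaro_number (\<alpha> + \<beta>) n * z ^ n)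
      = (\<Sum>n. cesaro_number \<alpha> n * z ^ n) * (\<Sum>n. cesaro_number \<beta> n * z ^ n)"
    unfolding conv by (rule Cauchy_product[OF assms, symmetric])
qed

lemma cesaro_number_0: "cesaro_number 0 n = (if n = 0 then 1 else 0)"
  by (cases n) (simp_all add: cesaro_number_def pochhammer_rec)

lemma cesaro_series_power:
  assumes "summable (\<lambda>n. norm (cesaro_number \<alpha> n * z ^ n))"
  shows "summable (\<lambda>n. norm (cesaro_number (\<alpha> * of_nat j) n * z ^ n))
    \<and> (\<Sum>n. norm (cesaro_number (\<alpha> * of_nat j) n * z ^ n))
      \<le> (\<Sum>n. norm (cesaro_number \<alpha> n * z ^ n)) ^ j
    \<and> (\<Sum>n. cesaro_number (\<alpha> * of_nat j) n * z ^ n) = (\<Sum>n. cesaro_number \<alpha> n * z ^ n) ^ j"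
proof (induction j)
  case 0
  have "(\<lambda>n. norm (cesaro_number 0 n * z ^ n)) sums 1" "(\<lambda>n. cesaro_number 0 n * z ^ n) sums 1"
    using sums_single[of 0 "\<lambda>_. 1::real"] sums_single[of 0 "\<lambda>_. 1::complex"]
    by (auto simp: cesaro_number_0 if_distrib[of norm] if_distrib[of "\<lambda>x. x * _"]
             elim!: sums_cong[THEN iffD1, rotated])
  then show ?case by (auto simp: sums_iff)
next
  case (Suc j)
  let ?K = "\<lambda>\<alpha>. \<Sum>n. norm (cesaro_number \<alpha> n * z ^ n)"
  have arg: "\<alpha> * of_nat (Suc j) = \<alpha> + \<alpha> * of_nat j"
    by (simp add: algebra_simps)
  note add = cesaro_series_add[OF assms conjunct1[OF Suc.IH], folded arg]
  have "?K (\<alpha> * of_nat (Suc j)) \<le> ?K \<alpha> * ?K (\<alpha> * of_nat j)"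
    by (rule add(2))
  also have "\<dots> \<le> ?K \<alpha> * ?K \<alpha> ^ j"
    using Suc.IH assms by (intro mult_left_mono suminf_nonneg) auto
  finally show ?case using add(1,3) Suc.IH by simp
qed

section \<open>The polynomials as exponential generating functions\<close>

text \<open>
  This is the meaning of the array $b_{l,n;a}$: it is the matrix of $x \mapsto ax$ in the basis of
  falling factorials. The recursion results from multiplying by $ax - n$ and using
  $x (x)_l = (x)_{l+1} + l (x)_l$.
\<close>

lemma falling_factorial_scaled:
  assumes "n \<ge> 1"
  shows "falling_factorial (a * x) n = (\<Sum>l=1..n. b_array a n l * falling_factorial x l)"
  using assms
proof (induction n rule: nat_induct_at_least)
  case base
  show ?case by (simp add: falling_factorial_def)
next
  case (Suc n)
  \<comment> \<open>With the values \<open>0\<close> at \<open>l = 0\<close> and \<open>l = n + 1\<close>, the recursion for \<open>2 \<le> l \<le> n\<close>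
    extends to the two boundary columns.\<close>
  have b0: "b_array a n 0 = 0" using Suc.hyps by (cases n) auto
  have bS: "b_array a n (Suc n) = 0" using Suc.hyps by (cases n) auto
  have step: "b_array a (Suc n) l = (a * of_nat l - of_nat n) * b_array a n l + a * b_array a n (l - 1)"
    if l: "l \<in> {1..Suc n}" for l
  proof -
    consider "l = 1" | "l = Suc n" | "2 \<le> l" "l \<le> n" using l by force
    then show ?thesis
    proof cases
      case 1
      then show ?thesis using b_array_1[of n a] b0 Suc.hyps by (simp add: falling_factorial_Suc)
    next
      case 2
      then show ?thesis using b_array_diag[of n a] bS Suc.hyps by (simp del: b_array.simps add: b_array_diag)
    next
      case 3
      then show ?thesis using b_array_rec[of l n a] by simp
    qed
  qed
  have "falling_factorial (a * x) (Suc n) =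
      (\<Sum>l=1..n. b_array a n l * falling_factorial x l * (a * x - of_nat n))"
    by (simp add: falling_factorial_Suc Suc.IH sum_distrib_right)
  also have "\<dots> = (\<Sum>l=1..n. (a * of_nat l - of_nat n) * b_array a n l * falling_factorial x l)
      + (\<Sum>l=1..n. a * b_array a n l * falling_factorial x (Suc l))"
    unfolding sum.distrib[symmetric]
    by (intro sum.cong) (auto simp: falling_factorial_Suc algebra_simps)
  also have "(\<Sum>l=1..n. a * b_array a n l * falling_factorial x (Suc l))
      = (\<Sum>l=1..Suc n. a * b_array a n (l - 1) * falling_factorial x l)"
    by (subst sum.atLeast_Suc_atMost, simp, simp only: One_nat_def sum.shift_bounds_cl_Suc_ivl)
       (simp add: b0 del: b_array.simps)
  also have "(\<Sum>l=1..n. (a * of_nat l - of_nat n) * b_array a n l * falling_factorial x l)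
      = (\<Sum>l=1..Suc n. (a * of_nat l - of_nat n) * b_array a n l * falling_factorial x l)"
    by (simp add: bS del: b_array.simps)
  also have "\<dots> + (\<Sum>l=1..Suc n. a * b_array a n (l - 1) * falling_factorial x l)
      = (\<Sum>l=1..Suc n. b_array a (Suc n) l * falling_factorial x l)"
    unfolding sum.distrib[symmetric]
    by (intro sum.cong refl) (simp only: step distrib_right)
  finally show ?case .
qed

text \<open>
  The terms with $j < l$ vanish, and $(j+l)_l / (j+l)! = 1/j!$, so the series is the exponential
  series shifted by $l$ places.
\<close>

lemma exp_series_falling_factorial:
  "(\<lambda>j. x ^ j / fact j * falling_factorial (of_nat j) l) sums (x ^ l * exp x)"
proof -
  let ?f = "\<lambda>j. x ^ j / fact j * falling_factorial (of_nat j) l"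
  have zero: "falling_factorial (of_nat j) l = 0" if "j < l" for j
    using that by (auto simp: falling_factorial_def)
  have shift: "?f (j + l) = x ^ l * (x ^ j / fact j)" for j
  proof -
    have "falling_factorial (of_nat (j + l)) l = fact l * of_nat ((j + l) choose l)"
      by (simp only: falling_factorial_eq_gbinomial binomial_gbinomial)
    also have "\<dots> = fact (j + l) / fact j"
      by (subst binomial_fact) auto
    finally have ff: "falling_factorial (of_nat (j + l)) l = fact (j + l) / fact j" .
    show ?thesis unfolding ff by (simp add: power_add)
  qed
  have "(\<lambda>j. ?f (j + l)) sums (x ^ l * exp x)"
    unfolding shift using exp_converges[of x] by (intro sums_mult) (simp add: scaleR_conv_of_real field_simps)
  moreover have "(\<Sum>j<l. ?f j) = 0" by (simp add: zero)
  ultimately show ?thesis using sums_iff_shift'[of ?f l] sums_iff_shift[of ?f l "x ^ l * exp x"] by simp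
qed

lemma p_poly_sums:
  "(\<lambda>j. (-1) ^ n * ((- t) ^ j / fact j) * (falling_factorial (a * of_nat j) n / fact n))
     sums (exp (- t) * p_poly a n t)"
proof (cases "n = 0")
  case True
  then show ?thesis
    using exp_converges[of "-t"]
    by (simp add: p_poly_def falling_factorial_def scaleR_conv_of_real field_simps)
next
  case False
  have "(\<lambda>j. (-1) ^ n / fact n * (\<Sum>l=1..n. b_array a n l *
           ((- t) ^ j / fact j * falling_factorial (of_nat j) l)))
        sums ((-1) ^ n / fact n * (\<Sum>l=1..n. b_array a n l * ((- t) ^ l * exp (- t))))"
    by (intro sums_mult sums_sum exp_series_falling_factorial)
  also have "(-1) ^ n / fact n * (\<Sum>l=1..n. b_array a n l * ((- t) ^ l * exp (- t)))
      = exp (- t) * p_poly a n t"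
    using False by (simp add: p_poly_def sum_distrib_left mult_ac)
  also have "(\<lambda>j. (-1) ^ n / fact n * (\<Sum>l=1..n. b_array a n l *
           ((- t) ^ j / fact j * falling_factorial (of_nat j) l)))
      = (\<lambda>j. (-1) ^ n * ((- t) ^ j / fact j) * (falling_factorial (a * of_nat j) n / fact n))"
    using False by (simp add: falling_factorial_scaled sum_distrib_left sum_divide_distrib mult_ac)
  finally show ?thesis .
qed

lemma p_poly_sums_cesaro:
  "(\<lambda>j. cesaro_number (- a * of_nat j) n * ((- t) ^ j / fact j)) sums (exp (- t) * p_poly a n t)"
proof -
  have "cesaro_number (- a * of_nat j) n * ((- t) ^ j / fact j)
      = (-1) ^ n * ((- t) ^ j / fact j) * (falling_factorial (a * of_nat j) n / fact n)" for j
    using cesaro_number_uminus[of "a * of_nat j" n]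
    by (simp add: falling_factorial_eq_gbinomial)
  then show ?thesis using p_poly_sums by presburger
qed

section \<open>Exchange of summation\<close>

text \<open>
  Fubini's theorem for a double series dominated row by row, in a form that also records the
  $\ell^1$ bound for the column sums.
\<close>

lemma double_series_swap:
  fixes f :: "nat \<Rightarrow> nat \<Rightarrow> 'a::banach"
  assumes row_abs: "\<And>j. summable (\<lambda>n. norm (f j n))"
    and row_le: "\<And>j. (\<Sum>n. norm (f j n)) \<le> M j" and M: "M sums T"
    and row: "\<And>j. f j sums R j" and col: "\<And>n. (\<lambda>j. f j n) sums C n"
  shows "summable (\<lambda>n. norm (C n))" and "(\<Sum>n. norm (C n)) \<le> T" and "C sums (\<Sum>j. R j)"
proof -
  have nonneg: "0 \<le> (\<Sum>n. norm (f j n))" for j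
    by (simp add: row_abs suminf_nonneg)
  have row_infsum: "(\<Sum>\<^sub>\<infinity>n. norm (f j n)) = (\<Sum>n. norm (f j n))" for j
    using norm_summable_imp_has_sum[of "\<lambda>n. norm (f j n)" "\<Sum>n. norm (f j n)"] row_abs
    by (simp add: infsumI summable_sums)
  have sumN: "summable (\<lambda>j. \<Sum>n. norm (f j n))"
    using row_le nonneg by (intro summable_comparison_test'[OF sums_summable[OF M], of 0]) auto
  have abs: "(\<lambda>(j, n). f j n) abs_summable_on (UNIV \<times> UNIV)"
    using row_abs sumN nonneg
    unfolding Infinite_Sum.abs_summable_on_Sigma_iff
    by (auto simp: row_infsum summable_on_UNIV_nonneg_real_iff)
  then have abs': "(\<lambda>(j, n). norm (f j n)) summable_on (UNIV \<times> UNIV)"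
    by (simp add: case_prod_unfold)
  have sm: "(\<lambda>(j, n). f j n) summable_on (UNIV \<times> UNIV)"
    using abs by (rule abs_summable_summable)
  have swapped: "(\<lambda>(n, j). f j n) abs_summable_on (UNIV \<times> UNIV)"
    using abs' summable_on_swap[of "\<lambda>(j, n). norm (f j n)" UNIV UNIV] by (simp add: case_prod_unfold)
  have col_abs: "(\<lambda>j. f j n) abs_summable_on UNIV" for n
    using swapped unfolding Infinite_Sum.abs_summable_on_Sigma_iff by simp
  have norms: "(\<lambda>n. \<Sum>\<^sub>\<infinity>j. norm (f j n)) summable_on UNIV"
    using swapped unfolding Infinite_Sum.abs_summable_on_Sigma_iff by (simp add: infsum_nonneg)
  have C: "C n = (\<Sum>\<^sub>\<infinity>j. f j n)" for n
    using has_sum_imp_sums[OF has_sum_infsum[OF abs_summable_summable[OF col_abs]]] col sums_unique2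
    by blast
  have C_le: "norm (C n) \<le> (\<Sum>\<^sub>\<infinity>j. norm (f j n))" for n
    unfolding C by (rule norm_infsum_bound[OF col_abs])
  have norms': "(\<lambda>n. \<Sum>\<^sub>\<infinity>j. norm (f j n)) sums (\<Sum>\<^sub>\<infinity>n. \<Sum>\<^sub>\<infinity>j. norm (f j n))"
    using norms by (intro has_sum_imp_sums has_sum_infsum)
  show sumC: "summable (\<lambda>n. norm (C n))"
    using C_le by (intro summable_comparison_test'[OF sums_summable[OF norms'], of 0]) auto
  have "(\<Sum>n. norm (C n)) \<le> (\<Sum>\<^sub>\<infinity>n. \<Sum>\<^sub>\<infinity>j. norm (f j n))"
    using suminf_le[OF C_le sumC sums_summable[OF norms']] sums_unique[OF norms'] by simp
  also have "\<dots> = (\<Sum>\<^sub>\<infinity>j. \<Sum>\<^sub>\<infinity>n. norm (f j n))"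
    by (rule infsum_swap_banach[OF abs', symmetric])
  also have "\<dots> = (\<Sum>j. \<Sum>n. norm (f j n))"
    unfolding row_infsum
    by (intro infsumI sums_nonneg_imp_has_sum summable_sums sumN nonneg)
  also have "\<dots> \<le> T"
    using suminf_le[OF row_le sumN sums_summable[OF M]] sums_unique[OF M] by simp
  finally show "(\<Sum>n. norm (C n)) \<le> T" .
  have R: "R j = (\<Sum>\<^sub>\<infinity>n. f j n)" for j
    using norm_summable_imp_has_sum[OF row_abs row, of j] by (simp only: infsumI)
  have "(\<lambda>j. \<Sum>\<^sub>\<infinity>n. f j n) summable_on UNIV"
    using summable_on_Sigma_banach[OF sm] by simp
  then have "R sums (\<Sum>\<^sub>\<infinity>j. \<Sum>\<^sub>\<infinity>n. f j n)"
    unfolding R[symmetric] by (intro has_sum_imp_sums has_sum_infsum)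
  moreover have "C sums (\<Sum>\<^sub>\<infinity>n. \<Sum>\<^sub>\<infinity>j. f j n)"
    unfolding C[symmetric] using sumC
    by (intro has_sum_imp_sums has_sum_infsum norm_summable_imp_summable_on)
  ultimately show "C sums (\<Sum>j. R j)"
    using infsum_swap_banach[OF sm] sums_unique by metis
qed

text \<open>
  Row $j$ of the double series is $k^{-aj}(n) z^n \frac{(-t)^j}{j!}$. Its norm is at most
  $\frac{(K|t|)^j}{j!}$ and its sum is $S^j \frac{(-t)^j}{j!}$, while column $n$ sums to
  $e^{-t} p_{n;a}(t) z^n$. The summand $1$ in $K + 1$ pays for the factor $e^{-t}$.
\<close>

lemma p_poly_generating_function:
  assumes "summable (\<lambda>n. norm (cesaro_number (- a) n * z ^ n))"
    and "(\<lambda>n. cesaro_number (- a) n * z ^ n) sums S"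
  defines "K \<equiv> \<Sum>n. norm (cesaro_number (- a) n * z ^ n)"
  shows "summable (\<lambda>n. norm (p_poly a n t * z ^ n))"
    and "(\<Sum>n. norm (p_poly a n t * z ^ n)) \<le> exp ((K + 1) * norm t)"
    and "(\<lambda>n. p_poly a n t * z ^ n) sums (exp t * exp (- t * S))"
proof -
  let ?e = "\<lambda>j. (- t) ^ j / fact j"
  let ?f = "\<lambda>j n. (cesaro_number (- a * of_nat j) n * z ^ n) * ?e j"
  note pow = cesaro_series_power[OF assms(1)]
  have abs: "summable (\<lambda>n. norm (?f j n))" for j
    unfolding norm_mult[of _ "?e j"] using pow by (intro summable_mult2) auto
  have le: "(\<Sum>n. norm (?f j n)) \<le> (K * norm t) ^ j / fact j" for j
  proof -
    have "(\<Sum>n. norm (?f j n)) = (\<Sum>n. norm (cesaro_number (- a * of_nat j) n * z ^ n)) * norm (?e j)"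
      unfolding norm_mult[of _ "?e j"] using pow[of j] by (intro suminf_mult2[symmetric]) auto
    also have "\<dots> \<le> K ^ j * norm (?e j)"
      using pow[of j] by (intro mult_right_mono) (auto simp: K_def)
    finally show ?thesis by (simp add: norm_divide norm_power power_mult_distrib)
  qed
  have M: "(\<lambda>j. (K * norm t) ^ j / fact j) sums exp (K * norm t)"
    using exp_converges[of "K * norm t"] by (simp add: field_simps)
  have row: "?f j sums (S ^ j * ?e j)" for j
    using pow[of j] sums_unique[OF assms(2)]
    by (intro sums_mult2) (auto simp: sums_iff intro: summable_norm_cancel)
  have col: "(\<lambda>j. ?f j n) sums (exp (- t) * (p_poly a n t * z ^ n))" for n
    using sums_mult2[OF p_poly_sums_cesaro[of a n t], of "z ^ n"] by (simp add: mult_ac)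
  note swap = double_series_swap[of ?f, OF abs le M row col]
  have eq: "p_poly a n t * z ^ n = exp t * (exp (- t) * (p_poly a n t * z ^ n))" for n
    by (simp add: exp_minus)
  show "summable (\<lambda>n. norm (p_poly a n t * z ^ n))"
    by (subst eq, subst norm_mult) (intro summable_mult swap(1))
  have "(\<Sum>n. norm (p_poly a n t * z ^ n)) = norm (exp t) * (\<Sum>n. norm (exp (- t) * (p_poly a n t * z ^ n)))"
    by (subst eq, subst norm_mult) (intro suminf_mult swap(1))
  also have "\<dots> \<le> exp (norm t) * exp (K * norm t)"
    using swap(2) by (intro mult_mono norm_exp suminf_nonneg swap(1)) auto
  also have "\<dots> = exp ((K + 1) * norm t)"
    by (simp add: exp_add[symmetric] algebra_simps)
  finally show "(\<Sum>n. norm (p_poly a n t * z ^ n)) \<le> exp ((K + 1) * norm t)" .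
  have "(\<lambda>j. S ^ j * ?e j) sums exp (- t * S)"
  proof -
    have "S ^ j * ?e j = (- t * S) ^ j /\<^sub>R fact j" for j
      by (simp add: power_mult_distrib[symmetric] scaleR_conv_of_real field_simps)
    then show ?thesis using exp_converges[of "- t * S"] by simp
  qed
  then have "(\<lambda>n. exp (- t) * (p_poly a n t * z ^ n)) sums exp (- t * S)"
    using swap(3) sums_unique by metis
  then show "(\<lambda>n. p_poly a n t * z ^ n) sums (exp t * exp (- t * S))"
    by (subst eq) (intro sums_mult)
qed

section \<open>Convergence of the binomial series\<close>

lemma cesaro_series_in_disc:
  assumes "norm z < 1"
  shows "summable (\<lambda>n. norm (cesaro_number (- a) n * z ^ n))"
    and "(\<lambda>n. cesaro_number (- a) n * z ^ n) sums ((1 - z) powr a)"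
proof -
  have eq: "cesaro_number (- a) n * w ^ n = (a gchoose n) * (- w) ^ n" for n w
    by (simp add: cesaro_number_uminus power_minus[of w])
  show "(\<lambda>n. cesaro_number (- a) n * z ^ n) sums ((1 - z) powr a)"
    unfolding eq using gen_binomial_complex[of "- z" a] assms by simp
  obtain r where r: "norm z < r" "r < 1" using assms dense by blast
  moreover have "0 \<le> r" using r norm_ge_zero[of z] by linarith
  ultimately have "norm (complex_of_real r) < 1" by simp
  then have "summable (\<lambda>n. cesaro_number (- a) n * complex_of_real r ^ n)"
    unfolding eq using gen_binomial_complex[of "- complex_of_real r" a] by (simp add: sums_iff)
  then show "summable (\<lambda>n. norm (cesaro_number (- a) n * z ^ n))"
    by (rule powser_insidea) (use r in auto)
qed

text \<open>
  Gamma function asymptotics of the binomial coefficients: $(-1)^n {a \choose n} n^{a+1}$ tends to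
  $1/\Gamma(-a)$.
\<close>

lemma cesaro_number_bigo:
  "(\<lambda>n. norm (cesaro_number (- a) n)) \<in> O(\<lambda>n. real n powr - (Re a + 1))"
proof -
  let ?g = "\<lambda>n. (-1) ^ n / exp ((a + 1) * of_real (ln (real n))) :: complex"
  have "(\<lambda>n. a gchoose n) \<in> O(?g)"
    using gbinomial_asymptotic[of a] by (intro bigoI_tendsto) auto
  then have "(\<lambda>n. norm (a gchoose n)) \<in> O(\<lambda>n. norm (?g n))"
    by simp
  also have "(\<lambda>n. norm (?g n)) \<in> \<Theta>(\<lambda>n. real n powr - (Re a + 1))"
    by (intro bigthetaI_cong eventually_mono[OF eventually_gt_at_top[of 0]])
       (simp add: norm_divide norm_mult norm_power powr_def exp_minus[symmetric] divide_inverse,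
        simp add: algebra_simps)
  finally show ?thesis
    by (simp add: cesaro_number_uminus norm_mult norm_power)
qed

lemma cesaro_number_abs_summable:
  assumes "Re a > 0"
  shows "summable (\<lambda>n. norm (cesaro_number (- a) n))"
  by (rule summable_comparison_test_bigo[OF _ cesaro_number_bigo])
     (use assms summable_real_powr_iff[of "- (Re a + 1)"] in simp)

lemma cesaro_number_partial_sum:
  "(\<Sum>i\<le>n. cesaro_number \<alpha> i) = cesaro_number (\<alpha> + 1) n"
proof -
  have "cesaro_number 1 k = 1" for k
    unfolding cesaro_number_def pochhammer_fact[symmetric] by simp
  then show ?thesis using cesaro_number_convolution[of \<alpha> 1 n] by simp
qed

text \<open>
  This is the value of $(1-z)^a$ at $z = 1$. The partial sums of $k^{-a}$ are the numbers $k^{1-a}(n)$,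
  which are $O(n^{-\mathrm{Re}\,a})$.
\<close>

lemma cesaro_number_sums_0:
  assumes "Re a > 0"
  shows "cesaro_number (- a) sums 0"
proof -
  have "(\<lambda>n. norm (cesaro_number (- (a - 1)) n)) \<in> O(\<lambda>n. real n powr - Re a)"
    using cesaro_number_bigo[of "a - 1"] by simp
  also have "(\<lambda>n. real n powr - Re a) \<in> o(\<lambda>_. 1)"
    using tendsto_neg_powr[OF _ filterlim_real_sequentially, of "- Re a"] assms
    by (intro smalloI_tendsto) auto
  finally have "(\<lambda>n. norm (cesaro_number (- (a - 1)) n)) \<longlonglongrightarrow> 0"
    by (auto dest: smalloD_tendsto)
  then have "(\<lambda>n. cesaro_number (- a + 1) n) \<longlonglongrightarrow> 0"
    by (simp add: tendsto_norm_zero_iff)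
  then show ?thesis
    by (simp add: sums_def_le cesaro_number_partial_sum)
qed

section \<open>The norm of the sequence of Cesaro numbers\<close>

lemma norm_pochhammer_ge:
  assumes "Re w > 0"
  shows "pochhammer (Re w) n \<le> norm (pochhammer w n)"
  unfolding pochhammer_prod prod_norm[symmetric]
proof (intro prod_mono conjI)
  fix i
  show "0 \<le> Re w + of_nat i" using assms by simp
  show "Re w + of_nat i \<le> norm (w + of_nat i)" using complex_Re_le_cmod[of "w + of_nat i"] by simp
qed

text \<open>
  In Euler's product formula for $\Gamma$ the numerators have equal modulus at $w$ and at
  $\mathrm{Re}\,w$, and each factor of the denominator has the smaller modulus at $\mathrm{Re}\,w$.
\<close>

lemma norm_Gamma_le:
  assumes "Re w > 0"
  shows "norm (Gamma w) \<le> Gamma (Re w)"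
proof (rule LIMSEQ_le[OF tendsto_norm[OF Gamma_series_LIMSEQ] Gamma_series_LIMSEQ], intro exI allI impI)
  fix n :: nat
  have "fact n * exp (Re w * ln (real n)) / norm (pochhammer w (n + 1))
      \<le> fact n * exp (Re w * ln (real n)) / pochhammer (Re w) (n + 1)"
  proof (rule divide_left_mono)
    show "pochhammer (Re w) (n + 1) \<le> norm (pochhammer w (n + 1))"
      by (rule norm_pochhammer_ge[OF assms])
    moreover have "0 < pochhammer (Re w) (n + 1)" by (rule pochhammer_pos[OF assms])
    ultimately show "0 < norm (pochhammer w (n + 1)) * pochhammer (Re w) (n + 1)"
      by (intro mult_pos_pos) linarith+
  qed simp
  then show "norm (Gamma_series w n) \<le> Gamma_series (Re w) n"
    by (simp add: Gamma_series_def norm_divide norm_mult)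
qed

text \<open>
  For $n \ge 1$ the numerator of $k^{-b}(n)$ is $-b (1-b)_{(n-1)}$ with a rising factorial, and
  $(1-b)_{(m)} = \Gamma(1-b+m) / \Gamma(1-b)$. Applying $|\Gamma(w)| \le \Gamma(\mathrm{Re}\,w)$ at
  $w = 1-b+m$ bounds the ratio to the real case by a constant independent of $n$.
\<close>

lemma norm_cesaro_number_le:
  assumes "0 < Re b" "Re b < 1"
  shows "norm (cesaro_number (- b) n)
    \<le> norm b / Re b * (Gamma (1 - Re b) / norm (Gamma (1 - b))) * norm (cesaro_number (- of_real (Re b)) n)"
proof -
  let ?G = "Gamma (1 - Re b) / norm (Gamma (1 - b))"
  have not_pole: "1 - b \<notin> \<int>\<^sub>\<le>\<^sub>0" "1 - Re b \<notin> \<int>\<^sub>\<le>\<^sub>0"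
    using assms by (auto elim!: nonpos_Ints_cases simp: complex_eq_iff)
  have Gamma_pos: "norm (Gamma (1 - b)) > 0" "Gamma (1 - Re b) > 0"
    using assms not_pole by (auto simp: Gamma_eq_zero_iff)
  have poch: "norm (pochhammer (1 - b) m) \<le> ?G * pochhammer (1 - Re b) m" for m
  proof -
    have "norm (Gamma (1 - b + of_nat m)) \<le> Gamma (1 - Re b + real m)"
      using norm_Gamma_le[of "1 - b + of_nat m"] assms by simp
    then show ?thesis
      using Gamma_pos by (simp add: pochhammer_Gamma not_pole norm_divide divide_right_mono)
  qed
  show ?thesis
  proof (cases n)
    case 0
    have "1 * 1 \<le> norm b / Re b * ?G"
      using poch[of 0] assms complex_Re_le_cmod[of b] by (intro mult_mono) (auto simp: divide_simps)
    with 0 show ?thesis by (simp add: cesaro_number_def)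
  next
    case (Suc m)
    have s: "norm (pochhammer (1 - complex_of_real (Re b)) m) = pochhammer (1 - Re b) m"
      using assms pochhammer_of_real[of "1 - Re b" m, where 'a = complex]
      by (simp del: pochhammer_of_real add: pochhammer_nonneg)
    have "norm b * norm (pochhammer (1 - b) m) / fact n \<le> norm b * (?G * pochhammer (1 - Re b) m) / fact n"
      by (intro divide_right_mono mult_left_mono poch) auto
    then show ?thesis
      using assms Suc
      by (simp add: cesaro_number_def pochhammer_rec norm_mult norm_divide s del: fact_Suc)
  qed
qed

lemma pochhammer_nonneg_real: "(x::real) \<ge> 0 \<Longrightarrow> pochhammer x n \<ge> 0"
  by (auto simp: pochhammer_prod intro!: prod_nonneg)

text \<open>
  All terms but the zeroth are nonpositive, so $\sum_{n \le N} |k^{-s}(n)| = 2 - \sum_{n \le N}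
  k^{-s}(n) = 2 - k^{1-s}(N)$.
\<close>

lemma ell1_norm_cesaro_real_le:
  assumes "0 < s" "s \<le> 1"
  shows "ell1_norm (cesaro_number (- of_real s)) \<le> 2"
  unfolding ell1_norm_def
proof (rule suminf_le_const)
  show "summable (\<lambda>n. norm (cesaro_number (- of_real s) n))"
    using assms by (intro cesaro_number_abs_summable) simp
  fix N
  have real: "cesaro_number (of_real x) n = of_real (pochhammer x n / fact n)" for x n
    by (simp add: cesaro_number_def pochhammer_of_real)
  have abs: "norm (cesaro_number (- of_real s) n) = (if n = 0 then 2 else 0) - Re (cesaro_number (- of_real s) n)" for n
  proof (cases n)
    case 0
    then show ?thesis by (simp add: cesaro_number_def)
  next
    case (Suc m)
    have "pochhammer (- s) n \<le> 0"
      using assms Suc pochhammer_nonneg_real[of "1 - s" m] by (simp add: pochhammer_rec mult_nonneg_nonneg)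
    then have "pochhammer (- s) n / fact n \<le> 0"
      by (intro divide_nonpos_pos) auto
    moreover have "cesaro_number (- of_real s) n = of_real (pochhammer (- s) n / fact n)"
      using real[of "- s" n] by simp
    ultimately show ?thesis
      using Suc by (simp only: norm_of_real Re_complex_of_real abs_of_nonpos) simp
  qed
  have "(\<Sum>n<N. norm (cesaro_number (- of_real s) n)) \<le> (\<Sum>n\<le>N. norm (cesaro_number (- of_real s) n))"
    by (intro sum_mono2) auto
  also have "\<dots> = 2 - Re (cesaro_number (- of_real s + 1) N)"
    unfolding abs cesaro_number_partial_sum[symmetric] by (simp add: sum_subtractf)
  also have "cesaro_number (- of_real s + 1) N = of_real (pochhammer (1 - s) N / fact N)"
    using real[of "1 - s" N] by simp
  also have "2 - Re (of_real (pochhammer (1 - s) N / fact N)) \<le> 2"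
    unfolding Re_complex_of_real using assms pochhammer_nonneg_real[of "1 - s" N] by simp
  finally show "(\<Sum>n<N. norm (cesaro_number (- of_real s) n)) \<le> 2" .
qed

text \<open>
  With $m = [\mathrm{Re}\,a]$ and $b = a - m$, the norm is at most
  $\Vert k^{-m}\Vert_1 \Vert k^{-b}\Vert_1 \le 2^m \cdot 2 \cdot C_b$, where $C_b$ is the ratio from the
  comparison with the real case; this product is $c_a$. If $\mathrm{Re}\,a$ is an integer, then either
  $a = m$ and the bound $2^m$ is half of $c_a$, or $a$ is not real and $c_a = \infty$.
\<close>

lemma ell1_norm_cesaro_le_c_const:
  assumes "Re a > 0"
  shows "ereal (ell1_norm (cesaro_number (- a))) \<le> c_const a"
proof -
  obtain m where m: "\<lfloor>Re a\<rfloor> = int m"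
    using assms by (metis nonneg_int_cases zero_le_floor less_imp_le)
  have one: "summable (\<lambda>n. norm (cesaro_number (- 1) n))"
    using cesaro_number_abs_summable[of 1] by simp
  have int: "summable (\<lambda>n. norm (cesaro_number (- of_nat m) n))"
       "ell1_norm (cesaro_number (- of_nat m)) \<le> 2 ^ m"
  proof -
    have "ell1_norm (cesaro_number (- 1)) ^ m \<le> 2 ^ m"
      using ell1_norm_cesaro_real_le[of 1] one by (intro power_mono) (auto simp: ell1_norm_def suminf_nonneg)
    then show "summable (\<lambda>n. norm (cesaro_number (- of_nat m) n))"
       "ell1_norm (cesaro_number (- of_nat m)) \<le> 2 ^ m"
      using cesaro_series_power[of "- 1" 1 m] one by (auto simp: ell1_norm_def)
  qed
  consider "a = of_int \<lfloor>Re a\<rfloor>" | "Re a \<in> \<int>" "Im a \<noteq> 0" | "Re a \<notin> \<int>"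
    using Ints_cases[of "Re a"] by (metis Re_complex_of_real complex_eq_iff Im_complex_of_real floor_of_int of_real_of_int_eq)
  then show ?thesis
  proof cases
    case 1
    then have "c_const a = ereal (2 powi (int m + 1))" using m by (intro c_const_integer) simp
    moreover have "2 ^ m \<le> (2::real) powi (int m + 1)" by (simp add: power_int_add)
    ultimately show ?thesis using 1 m int(2) by simp
  next
    case 2
    then show ?thesis by (simp add: c_const_infinity)
  next
    case 3
    define b where "b = a - of_nat m"
    have Re_b: "Re b = Re a - of_int \<lfloor>Re a\<rfloor>" using m by (simp add: b_def)
    have b: "0 < Re b" "Re b < 1"
      using 3 frac_gt_0_iff[of "Re a"] frac_lt_1[of "Re a"]
      by (auto simp: Re_b frac_def)
    let ?C = "norm b / Re b * (Gamma (1 - Re b) / norm (Gamma (1 - b)))"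
    have sb: "summable (\<lambda>n. norm (cesaro_number (- b) n))"
      "summable (\<lambda>n. norm (cesaro_number (- of_real (Re b)) n))"
      using b by (auto intro!: cesaro_number_abs_summable)
    have C: "?C \<ge> 0" using b by (auto intro!: mult_nonneg_nonneg divide_nonneg_nonneg less_imp_le[OF Gamma_real_pos])
    have "ell1_norm (cesaro_number (- b)) \<le> ?C * ell1_norm (cesaro_number (- of_real (Re b)))"
      unfolding ell1_norm_def suminf_mult[OF sb(2), symmetric]
      using b by (intro suminf_le norm_cesaro_number_le sb summable_mult)
    also have "\<dots> \<le> ?C * 2"
      using b C by (intro mult_left_mono ell1_norm_cesaro_real_le) auto
    finally have frac: "ell1_norm (cesaro_number (- b)) \<le> ?C * 2" .
    have "ell1_norm (cesaro_number (- a))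
        \<le> ell1_norm (cesaro_number (- of_nat m)) * ell1_norm (cesaro_number (- b))"
      using cesaro_series_add(2)[of "- of_nat m" 1 "- b"] int(1) sb(1) by (simp add: ell1_norm_def b_def)
    also have "\<dots> \<le> 2 ^ m * (?C * 2)"
      using frac int(2) sb by (intro mult_mono) (auto simp: ell1_norm_def suminf_nonneg)
    also have "\<dots> = 2 powi (\<lfloor>Re a\<rfloor> + 1) * (norm b / Re b) * (Gamma (1 - Re b) / norm (Gamma (1 - b)))"
      unfolding m by (simp add: power_int_add)
    also have "ereal \<dots> = c_const a"
      using c_const_eq[OF 3] m by (simp add: b_def)
    finally show ?thesis by simp
  qed
qed

section \<open>Representation, generating function and norm estimate\<close>

theorem theorem4p3:
  fixes a :: complex
  shows
    "(\<forall>(n::nat) (t::complex).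
        (\<lambda>j. (-1) ^ n * ((- t) ^ j / fact j) * (falling_factorial (a * of_nat j) n / fact n))
          sums (exp (- t) * p_poly a n t) \<and>
        (\<lambda>j. cesaro_number (- a * of_nat j) n * ((- t) ^ j / fact j))
          sums (exp (- t) * p_poly a n t)) \<and>
     (\<forall>(z::complex) (t::complex). norm z < 1 \<longrightarrow>
        summable (\<lambda>n. p_poly a n t * z ^ n) \<and>
        exp (- t) * (\<Sum>n. p_poly a n t * z ^ n) = exp (- t * (1 - z) powr a)) \<and>
     (Re a > 0 \<longrightarrow> (\<forall>t::complex. (\<lambda>n. p_poly a n t) sums exp t)) \<and>
     (Re a > 0 \<longrightarrow> (\<forall>t::complex.
        (\<lambda>n. p_poly a n t) \<in> ell1 \<and>
        ereal (ell1_norm (\<lambda>n. p_poly a n t)) \<le> exp_ereal ((c_const a + 1) * ereal (norm t))))"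
proof (intro conjI allI impI)
  fix n t
  show "(\<lambda>j. (-1) ^ n * ((- t) ^ j / fact j) * (falling_factorial (a * of_nat j) n / fact n))
          sums (exp (- t) * p_poly a n t)"
    by (rule p_poly_sums)
  show "(\<lambda>j. cesaro_number (- a * of_nat j) n * ((- t) ^ j / fact j))
          sums (exp (- t) * p_poly a n t)"
    by (rule p_poly_sums_cesaro)
next
  fix z t :: complex assume "norm z < 1"
  note gf = p_poly_generating_function(3)[OF cesaro_series_in_disc[OF this], of a t]
  show "summable (\<lambda>n. p_poly a n t * z ^ n)"
    using gf by (rule sums_summable)
  show "exp (- t) * (\<Sum>n. p_poly a n t * z ^ n) = exp (- t * (1 - z) powr a)"
    using sums_unique[OF gf, symmetric] by (simp add: exp_minus)
next
  fix t assume a: "Re a > 0"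
  have "summable (\<lambda>n. norm (cesaro_number (- a) n * 1 ^ n))" "(\<lambda>n. cesaro_number (- a) n * 1 ^ n) sums 0"
    using cesaro_number_abs_summable[OF a] cesaro_number_sums_0[OF a] by simp_all
  note gf = p_poly_generating_function[OF this, of t, simplified]
  show "(\<lambda>n. p_poly a n t) sums exp t" by (rule gf(3))
  show "(\<lambda>n. p_poly a n t) \<in> ell1" using gf(1) by (simp add: ell1_def)
  have le: "ereal (ell1_norm (\<lambda>n. p_poly a n t))
      \<le> ereal (exp ((ell1_norm (cesaro_number (- a)) + 1) * norm t))"
    using gf(2) by (simp add: ell1_norm_def)
  show "ereal (ell1_norm (\<lambda>n. p_poly a n t)) \<le> exp_ereal ((c_const a + 1) * ereal (norm t))"
  proof (cases "c_const a")
    case (real c)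
    then have "exp ((ell1_norm (cesaro_number (- a)) + 1) * norm t) \<le> exp ((c + 1) * norm t)"
      using ell1_norm_cesaro_le_c_const[OF a] by (simp add: mult_right_mono)
    with le real show ?thesis
      by (auto simp: one_ereal_def intro: order_trans)
  next
    case PInf
    \<comment> \<open>Since \<open>\<infinity> * 0 = 0\<close>, the right-hand side is finite at \<open>t = 0\<close>.\<close>
    show ?thesis
    proof (cases "t = 0")
      case True
      with le show ?thesis by (simp add: one_ereal_def zero_ereal_def[symmetric] exp_ereal_def)
    next
      case False
      with PInf show ?thesis by simp
    qed
  next
    case MInf
    then show ?thesis using ell1_norm_cesaro_le_c_const[OF a] by simp
  qed
qed

end
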